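(* For every $S\subseteq\mathbb{N}$, the problem $\textsc{NotIn}(S)$ is polynomial-time many-one reducible to $\textsc{HomInd}(\mathcal{K}^S)$.
   Context: All graphs are finite, undirected, without multiple edges; simple means without loops. $\hom(F,G)$ counts homomorphisms; $G\equiv_{\mathcal{F}}H$ means $\hom(F,G)=\hom(F,H)$ for all $F\in\mathcal{F}$. For a graph class $\mathcal{F}$, $\textsc{HomInd}(\mathcal{F})$ is the problem of deciding, given two graphs $G,H$, whether $G\equiv_{\mathcal{F}}H$. For $S\subseteq\mathbb{N}$, $\textsc{NotIn}(S)$ is the problem of deciding, given $n\in\mathbb{N}$ encoded in unary, whether $n\notin S$. $\mathcal{K}^S=\{K_{n_1}+\dots+K_{n_r}\mid r\in\mathbb{N},\ \{n_1,\dots,n_r\}\subseteq S\}$, where $K_n$ is the complete graph on $n$ vertices and $+$ is disjoint union. *)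

theory Defs
  imports Main "HOL-Library.FuncSet"
begin

text \<open>A graph is a pair (V, E) of a vertex set and an edge relation (symmetric;
  loops allowed in general, as in the paper). Only finite graphs are considered.\<close>

type_synonym 'a graph = "'a set \<times> ('a \<Rightarrow> 'a \<Rightarrow> bool)"

definition is_graph :: "'a graph \<Rightarrow> bool" where
  "is_graph G \<longleftrightarrow> finite (fst G) \<and>
     (\<forall>u\<in>fst G. \<forall>v\<in>fst G. snd G u v \<longleftrightarrow> snd G v u)"

definition hom :: "'a graph \<Rightarrow> 'b graph \<Rightarrow> nat" where
  "hom F G = card {h \<in> fst F \<rightarrow>\<^sub>E fst G.
      \<forall>u\<in>fst F. \<forall>v\<in>fst F. snd F u v \<longrightarrow> snd G (h u) (h v)}"

definition hom_equiv :: "'a graph set \<Rightarrow> 'b graph \<Rightarrow> 'b graph \<Rightarrow> bool" where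
  "hom_equiv \<F> G H \<longleftrightarrow> (\<forall>F\<in>\<F>. hom F G = hom F H)"

definition union_cliques :: "nat list \<Rightarrow> (nat \<times> nat) graph" where
  "union_cliques ns =
     ({(i, j). i < length ns \<and> j < ns ! i},
      \<lambda>(i, j) (i', j'). i = i' \<and> j \<noteq> j')"

definition K_class :: "nat set \<Rightarrow> (nat \<times> nat) graph set" where
  "K_class S = {union_cliques ns | ns. set ns \<subseteq> S}"

definition enc_graph :: "nat \<Rightarrow> (nat \<Rightarrow> nat \<Rightarrow> bool) \<Rightarrow> bool list" where
  "enc_graph n E = replicate n True @ [False] @
     concat (map (\<lambda>i. map (\<lambda>j. E i j) [0..<n]) [0..<n])"

definition HomInd :: "'a graph set \<Rightarrow> bool list set" where
  "HomInd \<F> = {enc_graph n E @ enc_graph m E' | n E m E'.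
      is_graph ({0..<n}, E) \<and> is_graph ({0..<m}, E') \<and>
      hom_equiv \<F> ({0..<n}, E) ({0..<m}, E')}"

definition NotIn :: "nat set \<Rightarrow> bool list set" where
  "NotIn S = {replicate n True | n. n \<notin> S}"

datatype dir = Left | Right | Stay

text \<open>A machine (Q, Sig, delta): states {0..<Q} with start state 0 and halting state 1,
  tape symbols {0..<Sig} with blank 0; bits are written as symbols 1 (False) and 2 (True).\<close>

type_synonym tm = "nat \<times> nat \<times> (nat \<Rightarrow> nat \<Rightarrow> nat \<times> nat \<times> dir)"

definition wf_tm :: "tm \<Rightarrow> bool" where
  "wf_tm M = (case M of (Q, Sig, \<delta>) \<Rightarrow> 2 \<le> Q \<and> 3 \<le> Sig \<and>
     (\<forall>q<Q. \<forall>a<Sig. case \<delta> q a of (q', b, d) \<Rightarrow> q' < Q \<and> b < Sig))"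

text \<open>Configuration: (state, cells left of the head in reverse order, cells from the head on).\<close>

type_synonym config = "nat \<times> nat list \<times> nat list"

fun tm_step :: "tm \<Rightarrow> config \<Rightarrow> config" where
  "tm_step (Q, Sig, \<delta>) (q, ls, rs) =
     (if q = 1 then (q, ls, rs) else
      (let a = (case rs of [] \<Rightarrow> 0 | x # _ \<Rightarrow> x);
           (q', b, d) = \<delta> q a;
           rs' = b # tl rs
       in case d of
            Stay \<Rightarrow> (q', ls, rs')
          | Right \<Rightarrow> (q', b # ls, tl rs)
          | Left \<Rightarrow> (case ls of [] \<Rightarrow> (q', [], 0 # rs') | l # ls' \<Rightarrow> (q', ls', l # rs'))))"

definition bit_sym :: "bool \<Rightarrow> nat" where
  "bit_sym b = (if b then 2 else 1)"

definition tm_computes_in_time :: "tm \<Rightarrow> (bool list \<Rightarrow> bool list) \<Rightarrow> (nat \<Rightarrow> nat) \<Rightarrow> bool" where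
  "tm_computes_in_time M f T \<longleftrightarrow>
     (\<forall>x. \<exists>t \<le> T (length x).
        (case (tm_step M ^^ t) (0, [], map bit_sym x) of (q, ls, rs) \<Rightarrow>
           q = 1 \<and> takeWhile (\<lambda>a. a \<noteq> 0) rs = map bit_sym (f x)))"

definition poly_time_computable :: "(bool list \<Rightarrow> bool list) \<Rightarrow> bool" where
  "poly_time_computable f \<longleftrightarrow>
     (\<exists>M c k. wf_tm M \<and> tm_computes_in_time M f (\<lambda>n. c * (n + 1) ^ k))"

definition poly_many_one_reducible :: "bool list set \<Rightarrow> bool list set \<Rightarrow> bool" where
  "poly_many_one_reducible A B \<longleftrightarrow>
     (\<exists>f. poly_time_computable f \<and> (\<forall>x. x \<in> A \<longleftrightarrow> f x \<in> B))"

end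

theory Submission
  imports Defs "HOL-Library.Countable" "HOL-Computational_Algebra.Polynomial"
begin

text \<open>
  The independence polynomials of paths satisfy \<open>p (a + 2) = p (a + 1) + x * p a\<close>, and Cassini's
  identity for this recurrence says that the independence polynomials of \<open>P\<^sub>n + P\<^sub>n\<^sub>-\<^sub>1\<close> and
  \<open>P\<^sub>n\<^sub>+\<^sub>1 + P\<^sub>n\<^sub>-\<^sub>2\<close> differ by exactly \<open>x ^ n\<close> up to sign. Hence the complements of these two graphs
  on \<open>2 * n - 1\<close> vertices admit the same number of homomorphisms from \<open>K\<^sub>m\<close> for every \<open>m \<noteq> n\<close>, but
  not for \<open>m = n\<close>; since homomorphism counts are multiplicative under disjoint union of the
  source, they are indistinguishable over \<open>K\<^sup>S\<close> iff \<open>n \<notin> S\<close>.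

  The reduction maps \<open>n \<ge> 3\<close> to this pair, looks up the answer for \<open>n < 3\<close>, and sends words that
  are not unary to the empty word, which encodes no pair of graphs. With the vertices numbered
  along the paths, the encoding is a concatenation of words that are produced by loops of nesting
  depth two over \<open>n - 3\<close>, and a Turing machine can keep the two loop counters as marks on its input.
\<close>

section \<open>Sweeping Turing machines\<close>

datatype 'q st = Init | Halt | Turn | Sweep 'q | Back 'q | Seek 'q | Return 'q

fun code :: "'q::countable st \<Rightarrow> nat" where
  "code Init = 0"
| "code Halt = 1"
| "code Turn = 2"
| "code (Sweep q) = 4 * to_nat q + 4"
| "code (Back q) = 4 * to_nat q + 5"
| "code (Seek q) = 4 * to_nat q + 6"
| "code (Return q) = 4 * to_nat q + 7"

lemma inj_code: "inj code"
proof (rule injI)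
  fix s t :: "'q::countable st"
  assume "code s = code t"
  then show "s = t"
    by (cases s; cases t) (simp_all, presburger+)
qed

text \<open>
  A machine that repeatedly sweeps over a workspace, initially its input. A sweep to the right
  rewrites the workspace by a finite transducer \<open>step\<close>; the state reached at the right end determines
  the relabelling \<open>wipe\<close> applied on the way back and, through \<open>fin\<close>, the state in which the next
  sweep starts and the bit to be output (\<open>None\<close>: halt). Output bits are added at the left end of a
  word that a blank separates from the workspace, hence the output is produced last bit first.
\<close>
locale sweeper =
  fixes step :: "'q::countable \<Rightarrow> nat \<Rightarrow> 'q \<times> nat"
    and wipe :: "'q \<Rightarrow> nat \<Rightarrow> nat"
    and fin :: "'q \<Rightarrow> ('q \<times> bool option) option"
    and q0 :: 'q
    and Qs :: "'q set"
    and Sig :: nat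
  assumes finite_Qs: "finite Qs"
    and q0: "q0 \<in> Qs"
    and Sig: "3 \<le> Sig"
    and step_in: "\<lbrakk>q \<in> Qs; 0 < a; a < Sig\<rbrakk> \<Longrightarrow>
      fst (step q a) \<in> Qs \<and> snd (step q a) \<in> {0<..<Sig}"
    and wipe_in: "\<lbrakk>q \<in> Qs; 0 < a; a < Sig\<rbrakk> \<Longrightarrow> wipe q a \<in> {0<..<Sig}"
    and fin_in: "\<lbrakk>q \<in> Qs; fin q = Some (q', e)\<rbrakk> \<Longrightarrow> q' \<in> Qs"
begin

fun sweep :: "'q \<Rightarrow> nat list \<Rightarrow> 'q \<times> nat list" where
  "sweep q [] = (q, [])"
| "sweep q (a # w) = (case step q a of (q', b) \<Rightarrow> case sweep q' w of (q'', w') \<Rightarrow> (q'', b # w'))"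

inductive round :: "'q \<times> nat list \<times> bool list \<Rightarrow> 'q \<times> nat list \<times> bool list \<Rightarrow> bool" where
  silent: "\<lbrakk>sweep q w = (p, w'); fin p = Some (q', None)\<rbrakk> \<Longrightarrow>
     round (q, w, out) (q', map (wipe p) w', out)"
| emit: "\<lbrakk>sweep q w = (p, w'); fin p = Some (q', Some b)\<rbrakk> \<Longrightarrow>
     round (q, w, out) (q', map (wipe p) w', out @ [b])"

text \<open>\<open>Init\<close> steps off the left end, and the blank created there becomes the
  separator. \<open>Seek\<close> runs to the left end of the output, \<open>Return\<close> back to
  the separator.\<close>

fun trans :: "'q st \<Rightarrow> nat \<Rightarrow> 'q st \<times> nat \<times> dir" where
  "trans Init a = (Turn, a, Left)"
| "trans Turn a = (Sweep q0, a, Right)"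
| "trans Halt a = (Halt, a, Stay)"
| "trans (Sweep q) a = (if a = 0 then (Back q, 0, Left)
     else (Sweep (fst (step q a)), snd (step q a), Right))"
| "trans (Back q) a = (if a \<noteq> 0 then (Back q, wipe q a, Left) else
     (case fin q of Some (q', None) \<Rightarrow> (Sweep q', 0, Right) | _ \<Rightarrow> (Seek q, 0, Left)))"
| "trans (Seek q) a = (if a \<noteq> 0 then (Seek q, a, Left) else
     (case fin q of Some (q', Some b) \<Rightarrow> (Return q', bit_sym b, Right) | _ \<Rightarrow> (Halt, 0, Right)))"
| "trans (Return q) a = (if a \<noteq> 0 then (Return q, a, Right) else (Sweep q, 0, Right))"

definition states :: "'q st set" where
  "states = {Init, Halt, Turn} \<union> Sweep ` Qs \<union> Back ` Qs \<union> Seek ` Qs \<union> Return ` Qs"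

text \<open>The junk value on pairs that are not reached keeps the table well-formed.\<close>
definition delta :: "nat \<Rightarrow> nat \<Rightarrow> nat \<times> nat \<times> dir" where
  "delta s a = (if s \<in> code ` states \<and> a < Sig
     then (case trans (inv code s) a of (t, b, d) \<Rightarrow> (code t, b, d)) else (0, 0, Stay))"

definition M :: tm where
  "M = (Suc (Max (code ` states)), Sig, delta)"

lemma finite_states: "finite states"
  unfolding states_def using finite_Qs by simp

lemma trans_in:
  assumes "s \<in> states" "a < Sig" "trans s a = (t, b, d)"
  shows "t \<in> states \<and> b < Sig"
proof -
  have [simp]: "bit_sym c < Sig" for c
    using Sig by (simp add: bit_sym_def)
  have blank: "0 < Sig" using Sig by simp
  consider "s = Init" | "s = Halt" | "s = Turn" | q where "s = Sweep q" "q \<in> Qs"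
    | q where "s = Back q" "q \<in> Qs" | q where "s = Seek q" "q \<in> Qs"
    | q where "s = Return q" "q \<in> Qs"
    using assms(1) unfolding states_def by blast
  then show ?thesis
  proof cases
    case (4 q)
    then show ?thesis
      using assms(2,3) step_in[of q a] blank by (auto simp: states_def split: if_splits)
  next
    case (5 q)
    then show ?thesis
      using assms(2,3) wipe_in[of q a] blank fin_in[of q]
      by (auto simp: states_def split: if_splits option.splits)
  next
    case (6 q)
    then show ?thesis
      using assms(2,3) blank fin_in[of q]
      by (auto simp: states_def split: if_splits option.splits)
  qed (use assms(2,3) q0 blank in \<open>auto simp: states_def split: if_splits\<close>)
qed

lemma wf_M: "wf_tm M"
proof -
  have "1 \<in> code ` states"
    by (rule image_eqI[of _ _ Halt]) (auto simp: states_def)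
  then have "1 \<le> Max (code ` states)"
    using finite_states by (simp add: Max_ge)
  moreover have "code t < Suc (Max (code ` states))" if "t \<in> states" for t
    using that finite_states by (simp add: less_Suc_eq_le)
  moreover have "case delta s a of (t, b, d) \<Rightarrow> t < Suc (Max (code ` states)) \<and> b < Sig"
    if "a < Sig" for s a
  proof (cases "s \<in> code ` states")
    case True
    then obtain u where u: "u \<in> states" "s = code u" by blast
    obtain t b d where t: "trans u a = (t, b, d)" by (metis prod_cases3)
    then show ?thesis
      using trans_in[OF u(1) that t] calculation(2)[of t] u that
      by (simp add: delta_def inv_f_f[OF inj_code])
  next
    case False
    then show ?thesis using Sig by (simp add: delta_def)
  qed
  ultimately show ?thesis
    using Sig unfolding wf_tm_def M_def by simp
qed

section \<open>Running times of the phases of a round\<close>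

definition reach :: "nat \<Rightarrow> 'q st \<times> nat list \<times> nat list \<Rightarrow> 'q st \<times> nat list \<times> nat list \<Rightarrow> bool" where
  "reach t c c' \<longleftrightarrow> (tm_step M ^^ t) (apfst code c) = apfst code c'"

lemma reach_trans:
  "\<lbrakk>reach s c c'; reach t c' c''\<rbrakk> \<Longrightarrow> reach (s + t) c c''"
  unfolding reach_def by (simp add: add.commute[of s] funpow_add)

lemma code_eq_iff [simp]: "code s = code t \<longleftrightarrow> s = t"
  by (rule inj_eq[OF inj_code])

lemma delta_code:
  assumes "s \<in> states" "a < Sig"
  shows "delta (code s) a = (case trans s a of (t, b, d) \<Rightarrow> (code t, b, d))"
  using assms by (simp add: delta_def inv_f_f[OF inj_code])

lemma code_eq_1: "code s = Suc 0 \<longleftrightarrow> s = Halt"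
  using code_eq_iff[of s Halt] by simp

lemma reach_Right:
  assumes "s \<in> states" "a < Sig" "s \<noteq> Halt" "trans s a = (t, b, Right)"
  shows "reach 1 (s, ls, a # rs) (t, b # ls, rs)"
  using assms by (simp add: reach_def M_def delta_code code_eq_1)

lemma reach_Left:
  assumes "s \<in> states" "a < Sig" "s \<noteq> Halt" "trans s a = (t, b, Left)"
  shows "reach 1 (s, l # ls, a # rs) (t, ls, l # b # rs)"
  using assms by (simp add: reach_def M_def delta_code code_eq_1)

lemma reach_Left_edge:
  assumes "s \<in> states" "a < Sig" "s \<noteq> Halt" "trans s a = (t, b, Left)"
  shows "reach 1 (s, [], a # rs) (t, [], 0 # b # rs)"
  using assms by (simp add: reach_def M_def delta_code code_eq_1)

text \<open>Past the end of the tape the head reads a blank, so a missing and an explicit blank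
  agree after one step; the blank right of the input is explicit only once the head has been
  there.\<close>

lemma reach_pad:
  assumes "reach (Suc t) (s, ls, [0]) c" "s \<noteq> Halt"
  shows "reach (Suc t) (s, ls, []) c"
proof -
  obtain t b d where "delta (code s) 0 = (t, b, d)" by (metis prod_cases3)
  then have "tm_step M (code s, ls, []) = tm_step M (code s, ls, [0])"
    using assms(2) by (cases d) (simp_all add: M_def code_eq_1)
  then show ?thesis
    using assms(1) by (simp add: reach_def funpow_swap1)
qed

lemma reach_sweep:
  assumes "q \<in> Qs" "set w \<subseteq> {0<..<Sig}" "sweep q w = (p, w')"
  shows "reach (length w) (Sweep q, ls, w @ rs) (Sweep p, rev w' @ ls, rs)
    \<and> p \<in> Qs \<and> set w' \<subseteq> {0<..<Sig} \<and> length w' = length w"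
  using assms
proof (induction w arbitrary: q ls w')
  case Nil
  then show ?case by (simp add: reach_def)
next
  case (Cons a w)
  obtain q' b where qb: "step q a = (q', b)" by fastforce
  obtain w'' where w'': "sweep q' w = (p, w'')" "w' = b # w''"
    using Cons.prems qb by (auto split: prod.splits)
  have q': "q' \<in> Qs" "b \<in> {0<..<Sig}"
    using step_in[of q a] Cons.prems qb by auto
  have "reach 1 (Sweep q, ls, a # w @ rs) (Sweep q', b # ls, w @ rs)"
    using Cons.prems qb by (intro reach_Right) (auto simp: states_def)
  from reach_trans[OF this] show ?case
    using Cons.IH[OF q'(1) _ w''(1), of "b # ls"] Cons.prems q' w'' by auto
qed

text \<open>Since \<open>v\<close> lists cells from right to left, the head stands on its first
  entry, or on the separator if \<open>v\<close> is empty; \<open>hd\<close> and \<open>tl\<close>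
  cover both cases.\<close>

lemma reach_back:
  assumes "q \<in> Qs" "set v \<subseteq> {0<..<Sig}"
  shows "reach (length v) (Back q, tl (v @ 0 # ls), hd (v @ 0 # ls) # rs)
    (Back q, ls, 0 # map (wipe q) (rev v) @ rs)"
  using assms
proof (induction v arbitrary: rs)
  case Nil
  then show ?case by (simp add: reach_def)
next
  case (Cons a v)
  have 1: "reach 1 (Back q, v @ 0 # ls, a # rs)
     (Back q, tl (v @ 0 # ls), hd (v @ 0 # ls) # wipe q a # rs)"
    using Cons.prems reach_Left[of "Back q" a "Back q" "wipe q a" "hd (v @ 0 # ls)" "tl (v @ 0 # ls)" rs]
    by (auto simp: states_def)
  show ?case
    using reach_trans[OF 1] Cons.IH[of "wipe q a # rs"] Cons.prems by auto
qed

lemma reach_seek: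
  assumes "q \<in> Qs" "set v \<subseteq> {0<..<Sig}" "0 < a" "a < Sig"
  shows "reach (Suc (length v)) (Seek q, v, a # rs) (Seek q, [], 0 # rev v @ a # rs)"
  using assms
proof (induction v arbitrary: a rs)
  case Nil
  then show ?case
    using reach_Left_edge[of "Seek q" a "Seek q" a rs] by (simp add: states_def)
next
  case (Cons l v)
  have 1: "reach 1 (Seek q, l # v, a # rs) (Seek q, v, l # a # rs)"
    using Cons.prems by (intro reach_Left) (auto simp: states_def)
  show ?case
    using reach_trans[OF 1 Cons.IH[of l "a # rs"]] Cons.prems by auto
qed

lemma reach_return:
  assumes "q \<in> Qs" "set v \<subseteq> {0<..<Sig}"
  shows "reach (Suc (length v)) (Return q, ls, v @ 0 # rs) (Sweep q, 0 # rev v @ ls, rs)"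
  using assms
proof (induction v arbitrary: ls)
  case Nil
  then show ?case
    using reach_Right[of "Return q" 0 "Sweep q" 0] Sig by (simp add: states_def)
next
  case (Cons a v)
  have 1: "reach 1 (Return q, ls, a # v @ 0 # rs) (Return q, a # ls, v @ 0 # rs)"
    using Cons.prems by (intro reach_Right) (auto simp: states_def)
  show ?case
    using reach_trans[OF 1 Cons.IH] Cons.prems by auto
qed

definition bits :: "bool list \<Rightarrow> nat list" where
  "bits = map bit_sym"

lemma bits_in: "set (bits out) \<subseteq> {0<..<Sig}"
  using Sig by (auto simp: bits_def bit_sym_def)

lemma reach_leftmost:
  assumes "q \<in> Qs" "fin q = None \<or> fin q = Some (q', Some b)"
  shows "reach (Suc (length out)) (Back q, bits out, 0 # rs)
    (Seek q, [], 0 # rev (bits out) @ 0 # rs)"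
proof (cases out)
  case Nil
  have "reach 1 (Back q, [], 0 # rs) (Seek q, [], 0 # 0 # rs)"
    using assms Sig by (intro reach_Left_edge) (auto simp: states_def)
  then show ?thesis using Nil by (simp add: bits_def)
next
  case (Cons c out')
  have 1: "reach 1 (Back q, bit_sym c # bits out', 0 # rs)
     (Seek q, bits out', bit_sym c # 0 # rs)"
    using assms Sig by (intro reach_Left) (auto simp: states_def)
  have "reach (Suc (length (bits out'))) (Seek q, bits out', bit_sym c # 0 # rs)
     (Seek q, [], 0 # rev (bits out') @ bit_sym c # 0 # rs)"
    using assms(1) bits_in Sig by (intro reach_seek) (auto simp: bit_sym_def)
  from reach_trans[OF 1 this] show ?thesis
    using Cons by (simp add: bits_def)
qed

lemma reach_separator:
  assumes "q \<in> Qs" "set w \<subseteq> {0<..<Sig}" "sweep q w = (p, w')" "z = [] \<or> z = [0]"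
  shows "reach (2 * length w + 1) (Sweep q, 0 # bits out, w @ z)
    (Back p, bits out, 0 # map (wipe p) w' @ [0])"
proof -
  note sw = reach_sweep[OF assms(1-3), of "0 # bits out" z]
  let ?l = "rev w' @ 0 # bits out"
  have "reach 1 (Sweep p, ?l, [0]) (Back p, tl ?l, hd ?l # [0])"
    using reach_Left[of "Sweep p" 0 "Back p" 0 "hd ?l" "tl ?l" "[]"] sw Sig
    by (auto simp: states_def)
  then have 2: "reach 1 (Sweep p, ?l, z) (Back p, tl ?l, hd ?l # [0])"
    using assms(4) reach_pad[of 0 "Sweep p" ?l] by auto
  have 3: "reach (length (rev w')) (Back p, tl ?l, hd ?l # [0])
      (Back p, bits out, 0 # map (wipe p) (rev (rev w')) @ [0])"
    using sw by (intro reach_back) auto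
  show ?thesis
    using reach_trans[OF reach_trans[OF conjunct1[OF sw] 2] 3] sw by (simp add: mult_2)
qed

lemma round_in:
  assumes "round (q, w, out) (q', w', out')" "q \<in> Qs" "set w \<subseteq> {0<..<Sig}"
  shows "q' \<in> Qs \<and> set w' \<subseteq> {0<..<Sig} \<and> length w' = length w \<and> length out' \<le> Suc (length out)"
  using assms(1)
proof cases
  case (silent p v)
  then show ?thesis
    using reach_sweep[OF assms(2,3) silent(3)] fin_in[of p] wipe_in[of p]
    by (fastforce simp: subset_iff)
next
  case (emit p v b)
  then show ?thesis
    using reach_sweep[OF assms(2,3) emit(3)] fin_in[of p] wipe_in[of p]
    by (fastforce simp: subset_iff)
qed

lemma reach_round:
  assumes "round (q, w, out) (q', w', out')" "q \<in> Qs" "set w \<subseteq> {0<..<Sig}" "z = [] \<or> z = [0]"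
  shows "\<exists>t \<le> 2 * length w + 2 * length out + 4.
    reach t (Sweep q, 0 # bits out, w @ z) (Sweep q', 0 # bits out', w' @ [0])"
  using assms(1)
proof cases
  case (silent p v)
  note sw = reach_sweep[OF assms(2,3) silent(3)]
  have "reach 1 (Back p, bits out, 0 # w' @ [0]) (Sweep q', 0 # bits out, w' @ [0])"
    using silent sw Sig by (intro reach_Right) (auto simp: states_def)
  then have "reach (2 * length w + 1 + 1) (Sweep q, 0 # bits out, w @ z) (Sweep q', 0 # bits out', w' @ [0])"
    using reach_trans[OF reach_separator[OF assms(2,3) silent(3) assms(4), of out], of 1] silent by simp
  then show ?thesis by (intro exI[of _ "2 * length w + 1 + 1"]) simp
next
  case (emit p v b)
  note sw = reach_sweep[OF assms(2,3) emit(3)]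
  let ?rs = "rev (bits out) @ 0 # w' @ [0]"
  have p: "p \<in> Qs" using sw by simp
  have q': "q' \<in> Qs" using fin_in[OF p emit(4)] .
  have 1: "reach (Suc (length out)) (Back p, bits out, 0 # w' @ [0]) (Seek p, [], 0 # ?rs)"
    using emit p by (intro reach_leftmost) auto
  have 2: "reach 1 (Seek p, [], 0 # ?rs) (Return q', [bit_sym b], ?rs)"
    using emit p Sig by (intro reach_Right) (auto simp: states_def)
  have 3: "reach (Suc (length (rev (bits out)))) (Return q', [bit_sym b], ?rs)
     (Sweep q', 0 # rev (rev (bits out)) @ [bit_sym b], w' @ [0])"
    using q' bits_in by (intro reach_return) auto
  have "reach (2 * length w + 1 + (Suc (length out) + 1 + Suc (length (rev (bits out)))))
     (Sweep q, 0 # bits out, w @ z) (Sweep q', 0 # bits out', w' @ [0])"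
    using reach_trans[OF reach_separator[OF assms(2,3) emit(3) assms(4), of out]
        reach_trans[OF reach_trans[OF 1 2] 3, unfolded emit(1)]] emit
    by (simp add: bits_def)
  then show ?thesis
    by (intro exI[of _ "2 * length w + 1 + (Suc (length out) + 1 + Suc (length (rev (bits out))))"])
      (simp add: bits_def)
qed

lemma reach_rounds:
  assumes "(round ^^ m) (q, w, out) (q', w', out')" "q \<in> Qs" "set w \<subseteq> {0<..<Sig}" "z = [] \<or> z = [0]"
  shows "\<exists>t z'. t \<le> m * (2 * length w + 2 * (length out + m) + 4) \<and> (z' = [] \<or> z' = [0]) \<and>
    reach t (Sweep q, 0 # bits out, w @ z) (Sweep q', 0 # bits out', w' @ z') \<and>
    q' \<in> Qs \<and> set w' \<subseteq> {0<..<Sig} \<and> length w' = length w \<and> length out' \<le> m + length out"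
  using assms(1)
proof (induction m arbitrary: q' w' out')
  case 0
  then show ?case using assms(2-) by (intro exI[of _ 0] exI[of _ z]) (simp add: reach_def)
next
  case (Suc m)
  obtain q1 w1 out1 where 1: "(round ^^ m) (q, w, out) (q1, w1, out1)"
    and r: "round (q1, w1, out1) (q', w', out')"
    using Suc.prems by auto
  obtain t z1 where t: "t \<le> m * (2 * length w + 2 * (length out + m) + 4)" "z1 = [] \<or> z1 = [0]"
    "reach t (Sweep q, 0 # bits out, w @ z) (Sweep q1, 0 # bits out1, w1 @ z1)"
    "q1 \<in> Qs" "set w1 \<subseteq> {0<..<Sig}" "length w1 = length w" "length out1 \<le> m + length out"
    using Suc.IH[OF 1] by blast
  obtain s where s: "s \<le> 2 * length w1 + 2 * length out1 + 4"
    "reach s (Sweep q1, 0 # bits out1, w1 @ z1) (Sweep q', 0 # bits out', w' @ [0])"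
    using reach_round[OF r t(4,5,2)] by blast
  have "t + s \<le> m * (2 * length w + 2 * (length out + Suc m) + 4) + (2 * length w + 2 * (length out + Suc m) + 4)"
    using t(1,6,7) s(1) by (intro add_mono order_trans[OF t(1)] mult_le_mono) auto
  then have "t + s \<le> Suc m * (2 * length w + 2 * (length out + Suc m) + 4)"
    by simp
  then show ?case
    using reach_trans[OF t(3) s(2)] round_in[OF r t(4,5)] t(6,7) by fastforce
qed

lemma reach_halt:
  assumes "q \<in> Qs" "set w \<subseteq> {0<..<Sig}" "sweep q w = (p, w')" "fin p = None" "z = [] \<or> z = [0]"
  shows "\<exists>rs. reach (2 * length w + length out + 3) (Sweep q, 0 # bits out, w @ z)
    (Halt, [0], rev (bits out) @ 0 # rs)"
proof -
  have p: "p \<in> Qs" using reach_sweep[OF assms(1-3)] by simp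
  let ?rs = "map (wipe p) w' @ [0]"
  have 1: "reach (Suc (length out)) (Back p, bits out, 0 # ?rs)
     (Seek p, [], 0 # rev (bits out) @ 0 # ?rs)"
    using assms p by (intro reach_leftmost) auto
  have 2: "reach 1 (Seek p, [], 0 # rev (bits out) @ 0 # ?rs) (Halt, [0], rev (bits out) @ 0 # ?rs)"
    using assms p Sig by (intro reach_Right) (auto simp: states_def)
  show ?thesis
    using reach_trans[OF reach_separator[OF assms(1-3,5), of out] reach_trans[OF 1 2]]
    by (auto simp: numeral_3_eq_3)
qed

lemma reach_start:
  "\<exists>z. (z = [] \<or> z = [0]) \<and> reach 2 (Init, [], bits x) (Sweep q0, [0], bits x @ z)"
proof -
  have *: "reach (Suc 1) (Init, [], a # rs) (Sweep q0, [0], a # rs)" if "a < Sig" for a rs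
  proof -
    have 1: "reach 1 (Init, [], a # rs) (Turn, [], 0 # a # rs)"
      using that by (intro reach_Left_edge) (auto simp: states_def)
    have 2: "reach 1 (Turn, [], 0 # a # rs) (Sweep q0, [0], a # rs)"
      using Sig by (intro reach_Right) (auto simp: states_def)
    show ?thesis using reach_trans[OF 1 2] by simp
  qed
  show ?thesis
  proof (cases x)
    case Nil
    have "reach (Suc 1) (Init, [], []) (Sweep q0, [0], [0])"
      using *[of 0 "[]"] Sig by (intro reach_pad) auto
    then show ?thesis using Nil by (auto simp: bits_def numeral_2_eq_2)
  next
    case (Cons b y)
    then show ?thesis
      using *[of "bit_sym b" "bits y"] Sig
      by (intro exI[of _ "[]"]) (auto simp: bits_def bit_sym_def numeral_2_eq_2)
  qed
qed

text \<open>The first emitted bit ends up last, hence \<open>rev (f x)\<close>. The output gains at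
  most one bit per round, so a round takes at most \<open>2 * n + 2 * R n + 4\<close> steps; start
  and halt fit into the additional factor.\<close>

theorem computes:
  assumes "\<And>x. \<exists>m q w p w'. m \<le> R (length x) \<and>
      (round ^^ m) (q0, map bit_sym x, []) (q, w, rev (f x)) \<and> sweep q w = (p, w') \<and> fin p = None"
  shows "tm_computes_in_time M f (\<lambda>n. (R n + 1) * (2 * n + 2 * R n + 5))"
  unfolding tm_computes_in_time_def
proof
  fix x
  obtain m q w p w' where m: "m \<le> R (length x)"
    and r: "(round ^^ m) (q0, bits x, []) (q, w, rev (f x))"
    and sw: "sweep q w = (p, w')" and fin: "fin p = None"
    using assms[of x] unfolding bits_def by blast
  obtain z where z: "z = [] \<or> z = [0]" and s: "reach 2 (Init, [], bits x) (Sweep q0, [0], bits x @ z)"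
    using reach_start by blast
  obtain t z' where t: "t \<le> m * (2 * length (bits x) + 2 * m + 4)" "z' = [] \<or> z' = [0]"
    "reach t (Sweep q0, [0], bits x @ z) (Sweep q, 0 # bits (rev (f x)), w @ z')"
    "q \<in> Qs" "set w \<subseteq> {0<..<Sig}" "length w = length x" "length (f x) \<le> m"
    using reach_rounds[OF r q0 bits_in z] by (auto simp: bits_def)
  obtain rs where h: "reach (2 * length w + length (rev (f x)) + 3)
      (Sweep q, 0 # bits (rev (f x)), w @ z') (Halt, [0], rev (bits (rev (f x))) @ 0 # rs)"
    using reach_halt[OF t(4,5) sw fin t(2), of "rev (f x)"] by blast
  let ?t = "2 + t + (2 * length w + length (rev (f x)) + 3)"
  have "reach ?t (Init, [], bits x) (Halt, [0], bits (f x) @ 0 # rs)"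
    using reach_trans[OF reach_trans[OF s t(3)] h] by (simp add: bits_def rev_map)
  moreover have "takeWhile (\<lambda>a. a \<noteq> 0) (bits (f x) @ 0 # rs) = bits (f x)"
    using bits_in[of "f x"] by (subst takeWhile_append2) auto
  moreover have "?t \<le> (R (length x) + 1) * (2 * length x + 2 * R (length x) + 5)"
  proof -
    have "t \<le> R (length x) * (2 * length x + 2 * R (length x) + 5)"
      using m by (intro order_trans[OF t(1)] mult_le_mono) (auto simp: bits_def)
    then show ?thesis using t(6,7) m by simp
  qed
  ultimately show "\<exists>t \<le> (R (length x) + 1) * (2 * length x + 2 * R (length x) + 5).
      case (tm_step M ^^ t) (0, [], map bit_sym x) of
        (q, ls, rs) \<Rightarrow> q = 1 \<and> takeWhile (\<lambda>a. a \<noteq> 0) rs = map bit_sym (f x)"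
    by (intro exI[of _ ?t]) (simp add: reach_def bits_def)
qed

end

section \<open>Clique counts in complements of paths\<close>

definition sparse :: "nat \<Rightarrow> nat set set" where
  "sparse a = {A. A \<subseteq> {..<a} \<and> (\<forall>j\<in>A. Suc j \<notin> A)}"

text \<open>The independence polynomial of the path on \<open>a\<close> vertices; integer
  coefficients allow the signs in Cassini's identity.\<close>

definition sparse_poly :: "nat \<Rightarrow> int poly" where
  "sparse_poly a = (\<Sum>A\<in>sparse a. monom 1 (card A))"

lemma finite_sparse: "finite (sparse a)"
  by (rule finite_subset[of _ "Pow {..<a}"]) (auto simp: sparse_def)

lemma finite_mem_sparse: "A \<in> sparse a \<Longrightarrow> finite A"
  by (auto simp: sparse_def intro: finite_subset)

lemma sparse_poly_0: "sparse_poly 0 = 1"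
proof -
  have "sparse 0 = {{}}" by (auto simp: sparse_def)
  then show ?thesis by (simp add: sparse_poly_def)
qed

lemma sparse_poly_1: "sparse_poly (Suc 0) = 1 + monom 1 1"
proof -
  have "sparse (Suc 0) = {{}, {0}}"
    by (auto simp: sparse_def lessThan_Suc)
  then show ?thesis by (simp add: sparse_poly_def)
qed

text \<open>An independent set either avoids the last vertex \<open>Suc a\<close>, or contains it
  and then avoids its neighbour \<open>a\<close>.\<close>

lemma sparse_Suc_Suc:
  "sparse (Suc (Suc a)) = sparse (Suc a) \<union> insert (Suc a) ` sparse a"
proof (rule set_eqI)
  fix A
  show "A \<in> sparse (Suc (Suc a)) \<longleftrightarrow> A \<in> sparse (Suc a) \<union> insert (Suc a) ` sparse a"
  proof (cases "Suc a \<in> A")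
    case False
    have "A \<subseteq> {..<Suc (Suc a)} \<longleftrightarrow> A \<subseteq> {..<Suc a}"
      using False less_Suc_eq by auto
    then show ?thesis using False by (auto simp: sparse_def)
  next
    case True
    then have "A \<notin> sparse (Suc a)" by (auto simp: sparse_def)
    moreover have "A - {Suc a} \<in> sparse a" if "A \<in> sparse (Suc (Suc a))"
    proof -
      have "x < a" if "x \<in> A - {Suc a}" for x
        using that True \<open>A \<in> sparse (Suc (Suc a))\<close>
        by (cases "x = a") (auto simp: sparse_def subset_iff less_Suc_eq)
      then show ?thesis using that by (auto simp: sparse_def)
    qed
    then have "A \<in> insert (Suc a) ` sparse a" if "A \<in> sparse (Suc (Suc a))"
      using that True by (intro image_eqI[of _ _ "A - {Suc a}"]) auto
    moreover have "A \<in> sparse (Suc (Suc a))" if "A \<in> insert (Suc a) ` sparse a"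
      using that by (fastforce simp: sparse_def)
    ultimately show ?thesis by auto
  qed
qed

lemma sparse_poly_Suc_Suc:
  "sparse_poly (Suc (Suc a)) = sparse_poly (Suc a) + monom 1 1 * sparse_poly a"
proof -
  have new: "Suc a \<notin> A" if "A \<in> sparse a" for A
    using that by (auto simp: sparse_def)
  have "sparse (Suc a) \<inter> insert (Suc a) ` sparse a = {}"
    by (auto simp: sparse_def)
  moreover have "inj_on (insert (Suc a)) (sparse a)"
    using new by (metis inj_onI insert_ident)
  ultimately have "sparse_poly (Suc (Suc a)) =
      sparse_poly (Suc a) + (\<Sum>A\<in>sparse a. monom 1 (card (insert (Suc a) A)))"
    unfolding sparse_poly_def sparse_Suc_Suc
    by (subst sum.union_disjoint) (auto simp: finite_sparse sum.reindex)
  also have "(\<Sum>A\<in>sparse a. monom 1 (card (insert (Suc a) A))) =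
      (\<Sum>A\<in>sparse a. monom 1 1 * monom (1::int) (card A))"
    by (rule sum.cong) (auto simp: new finite_mem_sparse mult_monom)
  finally show ?thesis by (simp add: sparse_poly_def sum_distrib_left)
qed

text \<open>The recurrence shows that increasing \<open>a\<close> by one multiplies the difference
  by \<open>- x\<close>; for \<open>a = 0\<close> it is \<open>x ^ 2\<close>.\<close>

lemma sparse_poly_cassini:
  "sparse_poly (a + 2) * sparse_poly (a + 1) - sparse_poly (a + 3) * sparse_poly a =
    monom ((- 1) ^ a) (a + 2)"
proof (induction a)
  case 0
  show ?case
    by (simp add: numeral_2_eq_2 numeral_3_eq_3 sparse_poly_Suc_Suc sparse_poly_0 sparse_poly_1
        algebra_simps mult_monom)
next
  case (Suc a)
  let ?p = sparse_poly and ?x = "monom 1 1 :: int poly"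
  have r: "?p (a + 4) = ?p (a + 3) + ?x * ?p (a + 2)" "?p (a + 3) = ?p (a + 2) + ?x * ?p (a + 1)"
    "?p (a + 2) = ?p (a + 1) + ?x * ?p a"
    using sparse_poly_Suc_Suc[of "a + 2"] sparse_poly_Suc_Suc[of "a + 1"] sparse_poly_Suc_Suc[of a]
    by (simp_all add: eval_nat_numeral)
  have "?p (a + 3) * ?p (a + 2) - ?p (a + 4) * ?p (a + 1) =
      - ?x * (?p (a + 2) * ?p (a + 1) - ?p (a + 3) * ?p a)"
    unfolding r by (simp add: algebra_simps)
  also have "\<dots> = monom ((- 1) ^ Suc a) (Suc a + 2)"
    unfolding Suc by (simp add: mult_monom minus_monom)
  finally show ?case by (simp add: eval_nat_numeral)
qed

text \<open>Adjacency in the complement of the path \<open>0, 1, 2, \<dots>\<close> from which the edge between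
  \<open>c - 1\<close> and \<open>c\<close> is removed.\<close>
definition cut_edge :: "nat \<Rightarrow> nat \<Rightarrow> nat \<Rightarrow> bool" where
  "cut_edge c i j \<longleftrightarrow> i \<noteq> j \<and> (Suc i = j \<longrightarrow> j = c) \<and> (Suc j = i \<longrightarrow> i = c)"

section \<open>Cliques in complements of disjoint paths\<close>

definition cliques :: "nat \<Rightarrow> (nat \<Rightarrow> nat \<Rightarrow> bool) \<Rightarrow> nat \<Rightarrow> nat set set" where
  "cliques N E m = {A. A \<subseteq> {0..<N} \<and> card A = m \<and> (\<forall>u\<in>A. \<forall>v\<in>A. u \<noteq> v \<longrightarrow> E u v)}"

lemma finite_cliques: "finite (cliques N E m)"
  by (rule finite_subset[of _ "Pow {0..<N}"]) (auto simp: cliques_def)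

text \<open>A clique here is an independent set in two disjoint paths on \<open>a\<close> and
  \<open>b\<close> vertices. Splitting it at \<open>a\<close> and shifting the upper part down gives
  a pair, and the product polynomial counts pairs by total size.\<close>

lemma card_cliques_cut:
  "int (card (cliques (a + b) (cut_edge a) m)) = coeff (sparse_poly a * sparse_poly b) m"
proof -
  let ?g = "\<lambda>(A, B). A \<union> (+) a ` B"
  let ?P = "{(A, B). (A, B) \<in> sparse a \<times> sparse b \<and> card A + card B = m}"
  have "bij_betw ?g ?P (cliques (a + b) (cut_edge a) m)"
  proof (rule bij_betw_byWitness[where f' = "\<lambda>A. (A \<inter> {..<a}, {j. a + j \<in> A})"])
    show "\<forall>p\<in>?P. (?g p \<inter> {..<a}, {j. a + j \<in> ?g p}) = p"
      by (auto simp: sparse_def)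
    show "\<forall>A\<in>cliques (a + b) (cut_edge a) m. ?g (A \<inter> {..<a}, {j. a + j \<in> A}) = A"
      by (auto simp: cliques_def image_iff) (metis le_add_diff_inverse not_less)
    show "?g ` ?P \<subseteq> cliques (a + b) (cut_edge a) m"
    proof clarify
      fix A B assume AB: "A \<in> sparse a" "B \<in> sparse b" "m = card A + card B"
      have "card (A \<union> (+) a ` B) = card A + card ((+) a ` B)"
        using AB by (intro card_Un_disjoint) (auto simp: finite_mem_sparse, auto simp: sparse_def)
      then have "card (A \<union> (+) a ` B) = card A + card B"
        by (simp add: card_image)
      then show "A \<union> (+) a ` B \<in> cliques (a + b) (cut_edge a) (card A + card B)"
      proof -
        have "cut_edge a u v" if "u \<in> A \<union> (+) a ` B" "v \<in> A \<union> (+) a ` B" "u \<noteq> v" for u v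
          using AB(1,2) that unfolding sparse_def cut_edge_def
          by (auto; metis add_Suc_right add_left_imp_eq)
        moreover have "A \<union> (+) a ` B \<subseteq> {0..<a + b}"
          using AB by (auto simp: sparse_def)
        ultimately show ?thesis
          using \<open>card (A \<union> (+) a ` B) = card A + card B\<close> by (simp add: cliques_def)
      qed
    qed
    show "(\<lambda>A. (A \<inter> {..<a}, {j. a + j \<in> A})) ` cliques (a + b) (cut_edge a) m \<subseteq> ?P"
    proof clarify
      fix A assume A: "A \<in> cliques (a + b) (cut_edge a) m"
      let ?B = "{j. a + j \<in> A}"
      have fin: "finite A" using A by (auto simp: cliques_def intro: finite_subset)
      \<comment> \<open>Consecutive vertices can share a clique only across the cut.\<close>
      have s: "Suc j \<notin> A" if "j \<in> A" "Suc j \<noteq> a" for j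
        using A that by (force simp: cliques_def cut_edge_def)
      have eq: "(A \<inter> {..<a}) \<union> (+) a ` ?B = A"
        by (auto simp: image_iff) (metis le_add_diff_inverse not_less)
      have fB: "finite ?B"
        using fin by (intro finite_subset[of ?B "(\<lambda>i. i - a) ` A"]) (auto simp: image_iff, metis add_diff_cancel_left')
      have "card A = card (A \<inter> {..<a}) + card ((+) a ` ?B)"
        using fin fB by (subst eq[symmetric], intro card_Un_disjoint) auto
      then have "card (A \<inter> {..<a}) + card ?B = m"
        using A by (simp add: card_image cliques_def)
      moreover have "?B \<subseteq> {..<b}" using A by (auto simp: cliques_def)
      moreover have "\<forall>j\<in>?B. Suc j \<notin> ?B" using s by force
      moreover have "\<forall>j\<in>A \<inter> {..<a}. Suc j \<notin> A \<inter> {..<a}" using s by auto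
      ultimately show "(A \<inter> {..<a}, ?B) \<in> sparse a \<times> sparse b \<and> card (A \<inter> {..<a}) + card ?B = m"
        by (auto simp: sparse_def)
    qed
  qed
  then have "card (cliques (a + b) (cut_edge a) m) = card ?P"
    by (simp add: bij_betw_same_card)
  moreover have "coeff (sparse_poly a * sparse_poly b) m =
      (\<Sum>p\<in>sparse a \<times> sparse b. of_bool (card (fst p) + card (snd p) = m))"
    unfolding sparse_poly_def sum_product mult_monom coeff_sum sum.cartesian_product
    by (auto intro!: sum.cong simp: coeff_sum)
  moreover have "\<dots> = int (card ?P)"
  proof -
    have "{p \<in> sparse a \<times> sparse b. card (fst p) + card (snd p) = m} = ?P" by auto
    then show ?thesis
      using sum.inter_filter[of "sparse a \<times> sparse b" "\<lambda>_. 1 :: int" "\<lambda>p. card (fst p) + card (snd p) = m"]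
      by (simp add: finite_sparse of_bool_def)
  qed
  ultimately show ?thesis by simp
qed

section \<open>Homomorphism counts from unions of cliques\<close>

definition clique_maps :: "nat \<Rightarrow> nat \<Rightarrow> (nat \<Rightarrow> nat \<Rightarrow> bool) \<Rightarrow> (nat \<Rightarrow> nat) set" where
  "clique_maps m N E = {h \<in> {..<m} \<rightarrow>\<^sub>E {0..<N}. \<forall>u<m. \<forall>v<m. u \<noteq> v \<longrightarrow> E (h u) (h v)}"

text \<open>Without loops a homomorphism from \<open>K_m\<close> is injective, so its image is an
  \<open>m\<close>-clique, and each such clique is the image of \<open>m!\<close>
  homomorphisms.\<close>

lemma card_clique_maps:
  assumes "\<And>i. \<not> E i i"
  shows "card (clique_maps m N E) = fact m * card (cliques N E m)"
proof -
  let ?F = "\<lambda>A. {h \<in> {..<m} \<rightarrow>\<^sub>E A. inj_on h {..<m}}"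
  have "clique_maps m N E = (\<Union>A\<in>cliques N E m. ?F A)"
  proof (intro equalityI subsetI)
    fix h assume h: "h \<in> clique_maps m N E"
    have inj: "inj_on h {..<m}"
      using h assms by (auto simp: clique_maps_def inj_on_def) metis
    then have "h ` {..<m} \<in> cliques N E m"
      using h by (auto simp: clique_maps_def cliques_def card_image)
    moreover have "h \<in> ?F (h ` {..<m})"
      using h inj by (auto simp: clique_maps_def PiE_def)
    ultimately show "h \<in> (\<Union>A\<in>cliques N E m. ?F A)" by blast
  next
    fix h assume "h \<in> (\<Union>A\<in>cliques N E m. ?F A)"
    then obtain A where A: "A \<in> cliques N E m" "h \<in> {..<m} \<rightarrow>\<^sub>E A" "inj_on h {..<m}" by blast
    have "h u \<in> A" if "u < m" for u using A that by auto
    moreover have "h u \<noteq> h v" if "u < m" "v < m" "u \<noteq> v" for u v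
      using A(3) that by (auto simp: inj_on_def)
    ultimately show "h \<in> clique_maps m N E"
      using A(1,2) by (auto simp: clique_maps_def cliques_def PiE_def Pi_def subset_iff)
  qed
  moreover have "card (\<Union>A\<in>cliques N E m. ?F A) = (\<Sum>A\<in>cliques N E m. card (?F A))"
  proof (rule card_UN_disjoint)
    show "\<forall>A\<in>cliques N E m. finite (?F A)"
    proof
      fix A assume "A \<in> cliques N E m"
      then have "finite A" by (auto simp: cliques_def intro: finite_subset)
      then have "finite ({..<m} \<rightarrow>\<^sub>E A)" by (intro finite_PiE) auto
      then show "finite (?F A)" by simp
    qed
    \<comment> \<open>An injection into a finite set of the same size is onto, so a map determines
      its clique and the families are disjoint.\<close>
    have im: "h ` {..<m} = A" if "A \<in> cliques N E m" "h \<in> ?F A" for h A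
    proof (rule card_subset_eq)
      show "finite A" using that by (auto simp: cliques_def intro: finite_subset)
      show "h ` {..<m} \<subseteq> A" using that by auto
      show "card (h ` {..<m}) = card A" using that by (auto simp: cliques_def card_image)
    qed
    show "\<forall>A\<in>cliques N E m. \<forall>B\<in>cliques N E m. A \<noteq> B \<longrightarrow> ?F A \<inter> ?F B = {}"
    proof (intro ballI impI equals0I)
      fix A B h assume AB: "A \<in> cliques N E m" "B \<in> cliques N E m" "A \<noteq> B" "h \<in> ?F A \<inter> ?F B"
      then show False using im[OF AB(1)] im[OF AB(2)] by (metis (no_types) IntD1 IntD2)
    qed
  qed (rule finite_cliques)
  moreover have "card (?F A) = fact m" if "A \<in> cliques N E m" for A
  proof -
    have "finite A" "card A = m" using that by (auto simp: cliques_def intro: finite_subset)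
    then show ?thesis
      using card_inj_on_subset_funcset[of "{..<m}" A "{..<m}"] by (simp add: fact_prod_rev)
  qed
  ultimately show ?thesis by simp
qed

text \<open>No edge joins two components, so currying a homomorphism gives an independent choice of
  one clique map per component.\<close>

lemma hom_union_cliques:
  "hom (union_cliques ns) ({0..<N}, E) = (\<Prod>i<length ns. card (clique_maps (ns ! i) N E))"
proof -
  let ?L = "{h \<in> fst (union_cliques ns) \<rightarrow>\<^sub>E {0..<N}. \<forall>u\<in>fst (union_cliques ns). \<forall>v\<in>fst (union_cliques ns).
     snd (union_cliques ns) u v \<longrightarrow> E (h u) (h v)}"
  let ?R = "\<Pi>\<^sub>E i\<in>{..<length ns}. clique_maps (ns ! i) N E"
  let ?to = "\<lambda>h. restrict (\<lambda>i. restrict (\<lambda>j. h (i, j)) {..<ns ! i}) {..<length ns}"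
  let ?from = "\<lambda>g. restrict (\<lambda>(i, j). g i j) (fst (union_cliques ns))"
  have "bij_betw ?to ?L ?R"
  proof (rule bij_betw_byWitness[where f' = ?from])
    show "\<forall>h\<in>?L. ?from (?to h) = h"
      by (auto simp: union_cliques_def fun_eq_iff PiE_def extensional_def)
    show "\<forall>g\<in>?R. ?to (?from g) = g"
    proof
      fix g assume g: "g \<in> ?R"
      show "?to (?from g) = g"
      proof (intro ext)
        fix i j
        show "?to (?from g) i j = g i j"
        proof (cases "i < length ns")
          case True
          then have "g i \<in> extensional {..<ns ! i}"
            using g by (auto simp: clique_maps_def PiE_def Pi_def)
          then show ?thesis using True by (auto simp: union_cliques_def extensional_def)
        next
          case False
          then have "g i = undefined" using g by (auto simp: PiE_def extensional_def)
          then show ?thesis using False by simp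
        qed
      qed
    qed
    show "?to ` ?L \<subseteq> ?R"
      by (auto simp: union_cliques_def clique_maps_def PiE_def Pi_def)
    show "?from ` ?R \<subseteq> ?L"
      by (fastforce simp: union_cliques_def clique_maps_def PiE_def Pi_def)
  qed
  then have "card ?L = card ?R" by (rule bij_betw_same_card)
  then show ?thesis unfolding hom_def by (simp add: card_PiE)
qed

text \<open>If \<open>n\<close> lies in \<open>S\<close>, the single clique \<open>[n]\<close>
  separates the graphs; otherwise the products agree factor by factor.\<close>

lemma hom_equiv_K_class:
  assumes "\<And>m. m \<noteq> n \<Longrightarrow> card (clique_maps m N E) = card (clique_maps m N' E')"
    and "card (clique_maps n N E) \<noteq> card (clique_maps n N' E')"
  shows "hom_equiv (K_class S) ({0..<N}, E) ({0..<N'}, E') \<longleftrightarrow> n \<notin> S"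
proof
  assume eq: "hom_equiv (K_class S) ({0..<N}, E) ({0..<N'}, E')"
  show "n \<notin> S"
  proof
    assume "n \<in> S"
    then have "union_cliques [n] \<in> K_class S" unfolding K_class_def by force
    with eq have "hom (union_cliques [n]) ({0..<N}, E) = hom (union_cliques [n]) ({0..<N'}, E')"
      unfolding hom_equiv_def by blast
    then show False using assms(2) by (simp add: hom_union_cliques)
  qed
next
  assume "n \<notin> S"
  then have "hom (union_cliques ns) ({0..<N}, E) = hom (union_cliques ns) ({0..<N'}, E')"
    if "set ns \<subseteq> S" for ns
    unfolding hom_union_cliques using that
    by (intro prod.cong) (auto intro!: assms(1) dest: nth_mem)
  then show "hom_equiv (K_class S) ({0..<N}, E) ({0..<N'}, E')"
    by (auto simp: hom_equiv_def K_class_def)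
qed

lemma hom_equiv_cut:
  "hom_equiv (K_class S) ({0..<2 * a + 3}, cut_edge (a + 2)) ({0..<2 * a + 3}, cut_edge (a + 3))
    \<longleftrightarrow> a + 2 \<notin> S"
proof -
  let ?c = "\<lambda>b m. card (cliques (2 * a + 3) (cut_edge b) m)"
  \<comment> \<open>These two splittings of the vertex set give the two products in Cassini's
    identity.\<close>
  have eq: "2 * a + 3 = (a + 2) + (a + 1)" "2 * a + 3 = (a + 3) + a" by simp_all
  have "int (?c (a + 2) m) = coeff (sparse_poly (a + 2) * sparse_poly (a + 1)) m" for m
    unfolding eq(1) by (rule card_cliques_cut)
  moreover have "int (?c (a + 3) m) = coeff (sparse_poly (a + 3) * sparse_poly a) m" for m
    unfolding eq(2) by (rule card_cliques_cut)
  ultimately have d: "int (?c (a + 2) m) - int (?c (a + 3) m) = (if m = a + 2 then (- 1) ^ a else 0)" for m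
    by (simp only: coeff_diff[symmetric] sparse_poly_cassini) auto
  have "?c (a + 2) m = ?c (a + 3) m" if "m \<noteq> a + 2" for m
    using d[of m] that by simp
  moreover have "?c (a + 2) (a + 2) \<noteq> ?c (a + 3) (a + 2)"
    using d[of "a + 2"] by auto
  ultimately show ?thesis
    by (intro hom_equiv_K_class) (simp_all add: card_clique_maps cut_edge_def)
qed

section \<open>Adjacency strings of path complements\<close>

lemma concat_grid:
  assumes "0 < m"
  shows "concat (map (\<lambda>i. map (g i) [0..<m]) [0..<l]) = map (\<lambda>k. g (k div m) (k mod m)) [0..<l * m]"
proof (induction l)
  case (Suc l)
  have "[0..<Suc l * m] = [0..<l * m] @ map (\<lambda>j. j + l * m) [0..<m]"
    using upt_add_eq_append[of 0 "l * m" m] by (simp add: map_add_upt add.commute)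
  then show ?case using Suc assms by simp
qed simp

text \<open>One period runs from entry \<open>(q, q)\<close> to just before
  \<open>(q + 1, q + 1)\<close>; its \<open>False\<close> entries are the diagonal and both
  orientations of the path edge between \<open>q\<close> and \<open>q + 1\<close>.\<close>

definition block :: "nat \<Rightarrow> bool list" where
  "block N = [False, False] @ replicate (N - 2) True @ [False]"

text \<open>For vertices \<open>r, s < N\<close> the position \<open>r * N + s\<close> equals \<open>r * (N + 1) + (s - r)\<close>, so the
  adjacency string of the complement of a path is periodic with period \<open>N + 1\<close>; the cut
  affects a single period.\<close>
lemma concat_cut_edge:
  assumes "N = c + b + 2"
  shows "concat (map (\<lambda>i. map (\<lambda>j. cut_edge (Suc c) i j) [0..<N]) [0..<N]) =
    concat (replicate c (block N)) @ (False # replicate N True) @ concat (replicate b (block N)) @ [False]"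
proof -
  \<comment> \<open>The entry at offset \<open>d\<close> of period \<open>q\<close>. Offsets
    \<open>1\<close> and \<open>N\<close> are \<open>(q, q + 1)\<close> and
    \<open>(q + 1, q)\<close>, which are adjacent only at the cut.\<close>
  define g where "g q d \<longleftrightarrow> d \<noteq> 0 \<and> (q = c \<or> d \<noteq> 1 \<and> d \<noteq> N)" for q d
  have coords: "(r * N + s) div N = r \<and> (r * N + s) mod N = s" if "s < N" for r s
    using that by simp
  \<comment> \<open>After \<open>N - 1\<close> full periods only the last diagonal entry
    remains.\<close>
  have len: "N * N = Suc ((N - 1) * Suc N)"
    using assms by (simp add: algebra_simps)
  have entry: "cut_edge (Suc c) (k div N) (k mod N) = g (k div Suc N) (k mod Suc N)"
    if k: "k < (N - 1) * Suc N" for k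
  proof -
    define q d where "q = k div Suc N" and "d = k mod Suc N"
    have k_eq: "k = q * Suc N + d" unfolding q_def d_def by (rule div_mult_mod_eq[symmetric])
    have d: "d \<le> N" unfolding d_def using mod_less_divisor[of "Suc N" k] by simp
    have q: "q < N - 1" unfolding q_def using k by (simp add: less_mult_imp_div_less)
    \<comment> \<open>Offset \<open>d\<close> either stays in row \<open>q\<close> or wraps around
      into row \<open>q + 1\<close>.\<close>
    show ?thesis
    proof (cases "q + d < N")
      case True
      have "k = q * N + (q + d)" using k_eq by simp
      then have "k div N = q" "k mod N = q + d" using coords[OF True] by simp_all
      then show ?thesis
        unfolding q_def[symmetric] d_def[symmetric] using True d q assms
        by (auto simp: cut_edge_def g_def)
    next
      case False
      then have "q + d = N + (q + d - N)" "q + d - N < N" using d q by auto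
      moreover have "k = q * N + (q + d)" using k_eq by simp
      ultimately have "k = Suc q * N + (q + d - N)" by simp
      then have "k div N = Suc q" "k mod N = q + d - N"
        using coords[OF \<open>q + d - N < N\<close>, of "Suc q"] by simp_all
      then show ?thesis
        unfolding q_def[symmetric] d_def[symmetric] using False d q assms
        by (auto simp: cut_edge_def g_def)
    qed
  qed
  have last: "\<not> cut_edge (Suc c) (((N - 1) * Suc N) div N) (((N - 1) * Suc N) mod N)"
  proof -
    have "(N - 1) * Suc N = (N - 1) * N + (N - 1)" by simp
    moreover have "N - 1 < N" using assms by simp
    ultimately have "((N - 1) * Suc N) div N = N - 1" "((N - 1) * Suc N) mod N = N - 1"
      using coords[of "N - 1" "N - 1"] by simp_all
    then show ?thesis by (simp add: cut_edge_def)
  qed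
  have row: "map (g q) [0..<Suc N] = (if q = c then False # replicate N True else block N)" for q
  proof (rule nth_equalityI)
    show "length (map (g q) [0..<Suc N]) = length (if q = c then False # replicate N True else block N)"
      using assms by (simp add: block_def)
    fix i assume "i < length (map (g q) [0..<Suc N])"
    then have "i \<le> N" by simp
    then show "map (g q) [0..<Suc N] ! i = (if q = c then False # replicate N True else block N) ! i"
      using assms by (auto simp: g_def block_def nth_Cons nth_append simp del: upt_Suc split: nat.split)
  qed
  have "concat (map (\<lambda>i. map (\<lambda>j. cut_edge (Suc c) i j) [0..<N]) [0..<N]) =
      map (\<lambda>k. cut_edge (Suc c) (k div N) (k mod N)) [0..<N * N]"
    using assms by (intro concat_grid) simp
  also have "\<dots> = map (\<lambda>k. g (k div Suc N) (k mod Suc N)) [0..<(N - 1) * Suc N] @ [False]"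
    unfolding len using entry last by simp
  also have "map (\<lambda>k. g (k div Suc N) (k mod Suc N)) [0..<(N - 1) * Suc N] =
      concat (map (\<lambda>q. if q = c then False # replicate N True else block N) [0..<N - 1])"
    by (simp only: concat_grid[symmetric] row zero_less_Suc)
  also have "[0..<N - 1] = [0..<c] @ c # [Suc c..<N - 1]"
    using assms by (simp add: upt_conv_Cons[symmetric] upt_add_eq_append[of 0 c "Suc b", simplified])
  also have "map (\<lambda>q. if q = c then False # replicate N True else block N) ([0..<c] @ c # [Suc c..<N - 1]) =
      replicate c (block N) @ (False # replicate N True) # replicate b (block N)"
    using assms by (auto simp: map_replicate_const[symmetric] intro!: map_cong replicate_eqI)
  finally show ?thesis by simp
qed

section \<open>Loop programs\<close>

text \<open>\<open>Loop d P\<close> runs \<open>P\<close> as often as there are counter cells, counting on track \<open>d\<close>.\<close>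
datatype com = Emit bool | Loop bool "com list"

instance com :: countable by countable_datatype

fun out :: "nat \<Rightarrow> com list \<Rightarrow> bool list" where
  "out k [] = []"
| "out k (Emit b # K) = b # out k K"
| "out k (Loop d P # K) = concat (replicate k (out k P)) @ out k K"

text \<open>One round per emitted bit, one per iteration to mark a cell, and one to leave a loop and
  wipe its marks.\<close>

fun rounds :: "nat \<Rightarrow> com list \<Rightarrow> nat" where
  "rounds k [] = 0"
| "rounds k (Emit b # K) = Suc (rounds k K)"
| "rounds k (Loop d P # K) = Suc (k * Suc (rounds k P)) + rounds k K"

fun tracks :: "com list \<Rightarrow> bool set" where
  "tracks [] = {}"
| "tracks (Emit b # K) = tracks K"
| "tracks (Loop d P # K) = insert d (tracks P \<union> tracks K)"

text \<open>An inner loop on the same track would destroy the counter of the outer one.\<close>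

fun nested :: "com list \<Rightarrow> bool" where
  "nested [] \<longleftrightarrow> True"
| "nested (Emit b # K) \<longleftrightarrow> nested K"
| "nested (Loop d P # K) \<longleftrightarrow> d \<notin> tracks P \<and> nested P \<and> nested K"

text \<open>The control state of the machine is the list of commands that remain to be executed;
  only finitely many such lists arise.\<close>
fun conts :: "com list \<Rightarrow> com list set" where
  "conts [] = {[]}"
| "conts (Emit b # K) = insert (Emit b # K) (conts K)"
| "conts (Loop d P # K) = insert (Loop d P # K) ((\<lambda>Q. Q @ Loop d P # K) ` conts P \<union> conts K)"

lemma finite_conts: "finite (conts K)"
  by (induction K rule: conts.induct) auto

lemma self_in_conts: "K \<in> conts K"
  by (cases K rule: conts.cases) auto

text \<open>Together with \<open>conts_Loop\<close> this closes \<open>conts K\<close> under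
  execution, so the control stays finite.\<close>

lemma conts_Emit: "Emit b # R \<in> conts K \<Longrightarrow> R \<in> conts K"
proof (induction K arbitrary: R rule: conts.induct)
  case (3 d P K)
  then consider "Emit b # R \<in> conts K" | Q where "Q \<in> conts P" "Emit b # R = Q @ Loop d P # K" by auto
  then show ?case
  proof cases
    case 2
    then obtain Q' where "Q = Emit b # Q'" "R = Q' @ Loop d P # K" by (cases Q) auto
    then show ?thesis using 3(1)[of Q'] 2 by auto
  qed (use 3 in auto)
qed (auto simp: self_in_conts)

lemma conts_Loop:
  "Loop e T # R \<in> conts K \<Longrightarrow> R \<in> conts K \<and> T @ Loop e T # R \<in> conts K"
proof (induction K arbitrary: R rule: conts.induct)
  case (3 d P K)
  then consider "Loop e T # R \<in> conts K" | "Loop e T # R = Loop d P # K"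
    | Q where "Q \<in> conts P" "Loop e T # R = Q @ Loop d P # K" by auto
  then show ?case
  proof cases
    case Q: 3
    show ?thesis
    proof (cases Q)
      case Nil
      then show ?thesis using Q self_in_conts by auto
    next
      case (Cons c Q')
      then have Q': "Q = Loop e T # Q'" "R = Q' @ Loop d P # K" using Q(2) by auto
      then have "Q' \<in> conts P" "T @ Loop e T # Q' \<in> conts P"
        using "3.IH"(1)[of Q'] Q by auto
      then have "Q' @ Loop d P # K \<in> conts (Loop d P # K)"
        "(T @ Loop e T # Q') @ Loop d P # K \<in> conts (Loop d P # K)"
        unfolding conts.simps by blast+
      then show ?thesis using Q' by simp
    qed
  next
    case 2
    then show ?thesis using self_in_conts by auto
  qed (use 3 in auto)
qed auto

lemma out_append: "out k (K @ L) = out k K @ out k L"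
  by (induction k K rule: out.induct) auto

lemma rounds_append: "rounds k (K @ L) = rounds k K + rounds k L"
  by (induction k K rule: rounds.induct) auto

section \<open>The program for the pair of graphs\<close>

definition ones :: "nat \<Rightarrow> com list" where
  "ones j = Loop False [Emit True] # Loop False [Emit True] # replicate j (Emit True)"

text \<open>For \<open>N = 2 * k + 5\<close> the ones of a block number
  \<open>N - 2 = 2 * k + 3\<close>, hence \<open>ones 3\<close>.\<close>

definition block_com :: "com list" where
  "block_com = Emit False # ones 3 @ [Emit False, Emit False]"

text \<open>Emits, last bit first, the encoding of the complement of a path on \<open>N = 2 * k + 5\<close>
  vertices that is cut before vertex \<open>k + c + 1\<close>, where \<open>k + c + k + b + 2 = N\<close>.\<close>
definition graph_com :: "nat \<Rightarrow> nat \<Rightarrow> com list" where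
  "graph_com c b = Emit False # Loop True block_com # concat (replicate b block_com) @
     ones 5 @ Emit False # Loop True block_com # concat (replicate c block_com) @ Emit False # ones 5"

text \<open>Output grows from its end, so the second graph is written first. The cuts
  \<open>k + 3\<close> and \<open>k + 4\<close> are those of \<open>hom_equiv_cut\<close> for
  \<open>a = k + 1\<close>.\<close>

definition pair_com :: "com list" where
  "pair_com = graph_com 3 0 @ graph_com 2 1"

lemma out_Emits: "out k (replicate j (Emit b)) = replicate j b"
  by (induction j) auto

lemma concat_replicate_single: "concat (replicate j [b]) = replicate j b"
  by (induction j) auto

lemma out_ones: "out k (ones j) = replicate (2 * k + j) True"
  by (simp add: ones_def out_Emits concat_replicate_single replicate_add mult_2)

lemma out_concat_replicate: "out k (concat (replicate j K)) = concat (replicate j (out k K))"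
  by (induction j) (auto simp: out_append)

lemma out_block: "out k block_com = rev (block (2 * k + 5))"
  by (simp add: block_com_def out_append out_ones block_def)

lemma rev_concat_replicate: "rev (concat (replicate j xs)) = concat (replicate j (rev xs))"
  by (simp add: rev_concat)

text \<open>The \<open>k\<close> copies of the block from each loop join the \<open>c\<close> or
  \<open>b\<close> explicit ones, which gives the right number of periods on either side of the
  cut.\<close>

lemma rev_out_graph_com:
  assumes "c + b = 3"
  shows "rev (out k (graph_com c b)) = enc_graph (2 * k + 5) (cut_edge (Suc (k + c)))"
proof -
  have "concat (map (\<lambda>i. map (\<lambda>j. cut_edge (Suc (c + k)) i j) [0..<2 * k + 5]) [0..<2 * k + 5]) =
     concat (replicate (c + k) (block (2 * k + 5))) @ (False # replicate (2 * k + 5) True) @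
     concat (replicate (b + k) (block (2 * k + 5))) @ [False]"
    using assms by (intro concat_cut_edge) simp
  then show ?thesis
    unfolding enc_graph_def graph_com_def
    by (simp add: out_append out_ones out_concat_replicate out_block rev_concat_replicate
        replicate_add[of _ _ "block (2 * k + 5)"] add.commute[of k] del: replicate.simps)
qed

lemma rev_out_pair_com:
  "rev (out k pair_com) = enc_graph (2 * k + 5) (cut_edge (k + 3)) @ enc_graph (2 * k + 5) (cut_edge (k + 4))"
  unfolding pair_com_def by (simp add: out_append rev_out_graph_com numeral_eq_Suc)

lemma rounds_Emits: "rounds k (replicate j (Emit b)) = j"
  by (induction j) auto

lemma rounds_ones: "rounds k (ones j) = 4 * k + 2 + j"
  by (simp add: ones_def rounds_Emits)

lemma rounds_block: "rounds k block_com = 4 * k + 8"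
  by (simp add: block_com_def rounds_append rounds_ones)

lemma rounds_concat_replicate: "rounds k (concat (replicate j K)) = j * rounds k K"
  by (induction j) (auto simp: rounds_append)

lemma rounds_pair_com: "rounds k pair_com \<le> 100 * (k + 1)\<^sup>2"
  unfolding pair_com_def graph_com_def
  by (simp add: rounds_append rounds_ones rounds_block rounds_concat_replicate power2_eq_square algebra_simps)

lemma nested_append: "nested (K @ L) \<longleftrightarrow> nested K \<and> nested L"
  by (induction K rule: nested.induct) auto

lemma nested_pair_com: "nested pair_com"
  unfolding pair_com_def graph_com_def
  by (simp add: nested_append block_com_def ones_def eval_nat_numeral)

text \<open>\<open>Check i\<close> verifies that the input is unary and turns its first three cells into dead cells
  (symbol 1). A live cell carries \<open>2\<close> plus \<open>1\<close> for a mark on track \<open>False\<close> plus \<open>2\<close> for a mark on track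
  \<open>True\<close>; the value of a counter is the number of marked cells. In front of a loop, \<open>Run\<close> looks
  for the first unmarked cell; after marking it the state is \<open>Hit\<close> and the loop body is entered. If
  all cells are marked, the loop is left and the marks are wiped on the way back.\<close>
datatype ctl = Check nat | Bad | Run "com list" | Hit "com list"

instance ctl :: countable by countable_datatype

text \<open>Live cells carry 2 to 5, so parity and \<open>4 \<le> a\<close> read off the two marks.
  The dead symbol 1 is odd too, which is why the transitions also test
  \<open>2 \<le> a\<close>.\<close>

definition marked :: "bool \<Rightarrow> nat \<Rightarrow> bool" where
  "marked d a \<longleftrightarrow> (if d then 4 \<le> a else odd a)"

definition mark :: "bool \<Rightarrow> nat" where
  "mark d = (if d then 2 else 1)"

fun ctl_step :: "ctl \<Rightarrow> nat \<Rightarrow> ctl \<times> nat" where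
  "ctl_step (Check i) a = (if a = 2 then if i < 3 then (Check (Suc i), 1) else (Check i, 2) else (Bad, a))"
| "ctl_step (Run (Loop d P # K)) a =
     (if 2 \<le> a \<and> \<not> marked d a then (Hit (Loop d P # K), a + mark d) else (Run (Loop d P # K), a))"
| "ctl_step q a = (q, a)"

fun ctl_wipe :: "ctl \<Rightarrow> nat \<Rightarrow> nat" where
  "ctl_wipe (Run (Loop d P # K)) a = (if 2 \<le> a \<and> marked d a then a - mark d else a)"
| "ctl_wipe q a = a"

text \<open>Of \<open>S\<close>, only the membership of 0, 1 and 2 is built into the machine. Two
  \<open>False\<close> bits encode a pair of empty graphs, the answer for short non-members.\<close>

fun ctl_fin :: "nat set \<Rightarrow> ctl \<Rightarrow> (ctl \<times> bool option) option" where
  "ctl_fin S (Check i) = (if i < 3 then if i \<in> S then None else Some (Run [Emit False, Emit False], None)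
     else Some (Run pair_com, None))"
| "ctl_fin S (Run (Emit b # K)) = Some (Run K, Some b)"
| "ctl_fin S (Run (Loop d P # K)) = Some (Run K, None)"
| "ctl_fin S (Hit (Loop d P # K)) = Some (Run (P @ Loop d P # K), None)"
| "ctl_fin S q = None"

definition ctl_states :: "ctl set" where
  "ctl_states = (let C = conts pair_com \<union> conts [Emit False, Emit False]
     in insert Bad (Check ` {..3} \<union> Run ` C \<union> Hit ` C))"

definition reduction :: "nat set \<Rightarrow> bool list \<Rightarrow> bool list" where
  "reduction S x = (if False \<in> set x then []
     else if length x < 3 then if length x \<in> S then [] else [False, False]
     else rev (out (length x - 3) pair_com))"

section \<open>Simulation of loop programs by sweeps\<close>

context
  fixes S :: "nat set"
begin

interpretation sweeper ctl_step ctl_wipe "ctl_fin S" "Check 0" ctl_states 6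
proof
  show "finite ctl_states"
    by (simp add: ctl_states_def Let_def finite_conts)
  show "Check 0 \<in> ctl_states" by (simp add: ctl_states_def Let_def)
  show "(3::nat) \<le> 6" by simp
next
  fix q a assume q: "q \<in> ctl_states" and a: "0 < a" "a < (6::nat)"
  show "fst (ctl_step q a) \<in> ctl_states \<and> snd (ctl_step q a) \<in> {0<..<6}"
  proof (cases "(q, a)" rule: ctl_step.cases)
    case (2 d P K a')
    have "a + mark d < 6" if "\<not> marked d a"
      using a that by (auto simp: marked_def mark_def split: if_splits elim!: evenE)
    then show ?thesis using 2 q a by (auto simp: ctl_states_def Let_def)
  qed (use q a in \<open>auto simp: ctl_states_def Let_def\<close>)
  show "ctl_wipe q a \<in> {0<..<6}"
    using a by (cases "(q, a)" rule: ctl_wipe.cases) (auto simp: mark_def marked_def)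
next
  fix q q' e assume q: "q \<in> ctl_states" and f: "ctl_fin S q = Some (q', e)"
  show "q' \<in> ctl_states"
    using q f
    by (cases "(S, q)" rule: ctl_fin.cases)
      (auto simp: ctl_states_def Let_def self_in_conts simp del: conts.simps
        split: if_splits dest: conts_Emit conts_Loop)
qed

lemma sweep_append:
  "sweep q (u @ v) = (case sweep q u of (p, u') \<Rightarrow> case sweep p v of (r, v') \<Rightarrow> (r, u' @ v'))"
  by (induction u arbitrary: q) (auto split: prod.splits)

lemma sweep_idle:
  assumes "\<And>a. a \<in> set w \<Longrightarrow> ctl_step q a = (q, a)"
  shows "sweep q w = (q, w)"
  using assms by (induction w) auto

definition cells :: "nat \<Rightarrow> (bool \<Rightarrow> nat) \<Rightarrow> nat list" where
  "cells k cnt = map (\<lambda>i. 2 + of_bool (i < cnt False) + 2 * of_bool (i < cnt True)) [0..<k]"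

definition tape :: "nat \<Rightarrow> (bool \<Rightarrow> nat) \<Rightarrow> nat list" where
  "tape k cnt = [1, 1, 1] @ cells k cnt"

lemma marked_cell:
  "marked d (2 + of_bool (i < cnt False) + 2 * of_bool (i < cnt True)) \<longleftrightarrow> i < cnt d"
  by (cases d) (auto simp: marked_def of_bool_def)

text \<open>The marked prefix is passed in state \<open>Run\<close>, the cell at index
  \<open>cnt d\<close> gets the mark, and \<open>Hit\<close> copies the rest.\<close>

lemma sweep_found:
  assumes "cnt d < k"
  shows "sweep (Run (Loop d P # K)) (tape k cnt) = (Hit (Loop d P # K), tape k (cnt(d := Suc (cnt d))))"
proof -
  let ?q = "Run (Loop d P # K)" and ?c = "cnt d"
  let ?g = "\<lambda>cnt i. 2 + of_bool (i < cnt False) + 2 * of_bool (i < cnt True) :: nat"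
  let ?u = "[1, 1, 1] @ map (?g cnt) [0..<?c]" and ?v = "map (?g cnt) [Suc ?c..<k]"
  have split: "[0..<k] = [0..<?c] @ ?c # [Suc ?c..<k]"
    using assms upt_add_eq_append[of 0 ?c "k - ?c"] by (simp add: upt_conv_Cons)
  have tape: "tape k cnt = ?u @ ?g cnt ?c # ?v"
    unfolding tape_def cells_def split by simp
  have "tape k (cnt(d := Suc ?c)) = ?u @ (?g cnt ?c + mark d) # ?v"
    unfolding tape_def cells_def split by (auto simp: mark_def)
  moreover have "sweep ?q ?u = (?q, ?u)"
  proof (rule sweep_idle)
    fix a assume "a \<in> set ?u"
    then consider "a = 1" | i where "i < ?c" "a = ?g cnt i" by auto
    then show "ctl_step ?q a = (?q, a)"
      using marked_cell[of d _ cnt] by cases (auto simp del: add_2_eq_Suc)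
  qed
  moreover have "sweep (Hit (Loop d P # K)) ?v = (Hit (Loop d P # K), ?v)"
    by (rule sweep_idle) simp
  ultimately show ?thesis
    unfolding tape sweep_append using marked_cell[of d ?c cnt] by (simp del: add_2_eq_Suc)
qed

lemma sweep_not_found:
  assumes "cnt d = k"
  shows "sweep (Run (Loop d P # K)) (tape k cnt) = (Run (Loop d P # K), tape k cnt)"
proof (rule sweep_idle)
  fix a assume "a \<in> set (tape k cnt)"
  then consider "a = 1" | i where "i < k" "a = 2 + of_bool (i < cnt False) + 2 * of_bool (i < cnt True)"
    by (auto simp: tape_def cells_def)
  then show "ctl_step (Run (Loop d P # K)) a = (Run (Loop d P # K), a)"
    using marked_cell[of d _ cnt] assms by cases (auto simp del: add_2_eq_Suc)
qed

lemma wipe_tape: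
  "map (ctl_wipe (Run (Loop d P # K))) (tape k cnt) = tape k (cnt(d := 0))"
  unfolding tape_def cells_def using marked_cell[of d _ cnt]
  by (auto simp: mark_def simp del: add_2_eq_Suc)

lemma map_wipe_id [simp]: "map (ctl_wipe (Hit K)) w = w" "map (ctl_wipe (Run (Emit b # K))) w = w"
  "map (ctl_wipe (Check i)) w = w"
  by (simp_all add: map_idI)

lemma round_Emit: "round (Run (Emit b # K), w, o') (Run K, w, o' @ [b])"
  using round.emit[of "Run (Emit b # K)" w "Run (Emit b # K)" w "Run K" b o']
  by (simp add: sweep_idle)

lemma round_Loop_enter:
  assumes "cnt d < k"
  shows "round (Run (Loop d P # K), tape k cnt, o')
    (Run (P @ Loop d P # K), tape k (cnt(d := Suc (cnt d))), o')"
  using round.silent[OF sweep_found[of cnt d k P K, OF assms], of "Run (P @ Loop d P # K)" o'] by simp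

lemma round_Loop_exit:
  assumes "cnt d = k"
  shows "round (Run (Loop d P # K), tape k cnt, o') (Run K, tape k (cnt(d := 0)), o')"
  using round.silent[OF sweep_not_found[of cnt d k P K, OF assms], of "Run K" o'] by (simp add: wipe_tape)

lemma relpowp_trans: "(r ^^ m) x y \<Longrightarrow> (r ^^ n) y z \<Longrightarrow> (r ^^ (m + n)) x z"
  by (auto simp: relpowp_add)

text \<open>A nested program finds the counters of its own tracks at zero, returns them to zero and
  keeps the others, so the counter of a loop survives its body. \<open>K\<close> is the
  continuation.\<close>

lemma rounds_Run:
  assumes "nested P" "\<And>d. d \<in> tracks P \<Longrightarrow> cnt d = 0"
  shows "(round ^^ rounds k P) (Run (P @ K), tape k cnt, o') (Run K, tape k cnt, o' @ out k P)"
  using assms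
proof (induction k P arbitrary: cnt K o' rule: out.induct)
  case (1 k)
  then show ?case by simp
next
  case (2 k b P)
  have "(round ^^ 1) (Run (Emit b # P @ K), tape k cnt, o') (Run (P @ K), tape k cnt, o' @ [b])"
    using round_Emit by (simp add: eq_OO)
  from relpowp_trans[OF this 2(1)] show ?case using 2 by simp
next
  case (3 k d P R)
  \<comment> \<open>Induction on the number \<open>j\<close> of iterations still to run; the counter
    then stands at \<open>k - j\<close>.\<close>
  have loop: "(round ^^ Suc (j * Suc (rounds k P))) (Run (Loop d P # R @ K), tape k (cnt(d := k - j)), p)
      (Run (R @ K), tape k (cnt(d := 0)), p @ concat (replicate j (out k P)))" if "j \<le> k" for j p
    using that
  proof (induction j arbitrary: p)
    case 0
    have "round (Run (Loop d P # R @ K), tape k (cnt(d := k)), p) (Run (R @ K), tape k (cnt(d := 0)), p)"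
      using round_Loop_exit[of "cnt(d := k)" d k P "R @ K" p] by simp
    then show ?case by (simp add: eq_OO fun_upd_def)
  next
    case (Suc j)
    let ?c = "cnt(d := k - j)"
    have "Suc (k - Suc j) = k - j" using Suc.prems by simp
    then have 1: "(round ^^ 1) (Run (Loop d P # R @ K), tape k (cnt(d := k - Suc j)), p)
        (Run (P @ Loop d P # R @ K), tape k ?c, p)"
      using round_Loop_enter[of "cnt(d := k - Suc j)" d k P "R @ K" p] Suc.prems by (simp add: eq_OO)
    have zero: "?c e = 0" if "e \<in> tracks P" for e
    proof -
      have "d \<notin> tracks P" using 3(3) by simp
      then have "e \<noteq> d" using that by (cases e; cases d) simp_all
      then show ?thesis using that 3(4)[of e] by simp
    qed
    have nest: "nested P" using 3(3) by simp
    have 2: "(round ^^ rounds k P) (Run (P @ Loop d P # R @ K), tape k ?c, p)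
        (Run (Loop d P # R @ K), tape k ?c, p @ out k P)"
      by (rule 3(1)[OF nest zero])
    show ?case
      using relpowp_trans[OF relpowp_trans[OF 1 2] Suc.IH[of "p @ out k P"]] Suc.prems
      by (simp add: fun_upd_def add.left_commute del: relpowp.simps)
  qed
  \<comment> \<open>The exit resets the counter to 0, its value before the loop.\<close>
  have "cnt(d := 0) = cnt" using 3(4)[of d] by (simp add: fun_upd_idem)
  then have "(round ^^ Suc (k * Suc (rounds k P))) (Run (Loop d P # R @ K), tape k cnt, o')
      (Run (R @ K), tape k cnt, o' @ concat (replicate k (out k P)))"
    using loop[of k o'] by (simp del: relpowp.simps)
  moreover have "(round ^^ rounds k R) (Run (R @ K), tape k cnt, o' @ concat (replicate k (out k P)))
      (Run K, tape k cnt, (o' @ concat (replicate k (out k P))) @ out k R)"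
  proof (rule 3(2))
    show "nested R" using 3(3) by simp
    show "cnt e = 0" if "e \<in> tracks R" for e using 3(4)[of e] that by simp
  qed
  ultimately show ?case
    using relpowp_trans by (fastforce simp del: relpowp.simps)
qed

lemma sweep_Check:
  "sweep (Check i) (replicate n 2) = (if i + n \<le> 3 then (Check (i + n), replicate n 1)
     else (Check 3, replicate (3 - i) 1 @ replicate (n - (3 - i)) 2))" if "i \<le> 3"
  using that
proof (induction n arbitrary: i)
  case (Suc n)
  show ?case
  proof (cases "i = 3")
    case True
    then show ?thesis using Suc.IH[of 3] by (auto split: if_splits)
  next
    case False
    then have "3 - i = Suc (3 - Suc i)" using Suc.prems by simp
    then show ?thesis using Suc.IH[of "Suc i"] Suc.prems False by auto
  qed
qed auto

lemma sweep_Bad: "sweep Bad w = (Bad, w)"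
  by (rule sweep_idle) simp

lemma sweep_Check_Bad:
  assumes "False \<in> set x"
  shows "fst (sweep (Check i) (map bit_sym x)) = Bad"
  using assms
  by (induction x arbitrary: i) (auto simp: bit_sym_def sweep_Bad case_prod_beta)

section \<open>Output and running time of the reduction\<close>

lemma rounds_reduction:
  "\<exists>m q w p w'. m \<le> 101 * (length x + 1)\<^sup>2 \<and>
     (round ^^ m) (Check 0, map bit_sym x, []) (q, w, rev (reduction S x)) \<and>
     sweep q w = (p, w') \<and> ctl_fin S p = None"
proof (cases "False \<in> set x")
  case True
  obtain p w' where sw: "sweep (Check 0) (map bit_sym x) = (p, w')" by fastforce
  then have "p = Bad" using sweep_Check_Bad[OF True, of 0] by simp
  then show ?thesis using sw True by (intro exI[of _ 0]) (auto simp: reduction_def)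
next
  case False
  define n where "n = length x"
  have x: "map bit_sym x = replicate n 2"
    using False by (intro replicate_eqI) (auto simp: n_def bit_sym_def)
  have stop: "\<exists>p w'. sweep (Run []) w = (p, w') \<and> ctl_fin S p = None" for w
    using sweep_idle[of w "Run []"] by simp
  show ?thesis
  proof (cases "n < 3")
    case True
    have sw: "sweep (Check 0) (replicate n 2) = (Check n, replicate n 1)"
      using True by (subst sweep_Check) auto
    show ?thesis
    proof (cases "n \<in> S")
      case True
      then show ?thesis
        using sw x False \<open>n < 3\<close> by (intro exI[of _ 0]) (auto simp: reduction_def n_def)
    next
      case not: False
      have 1: "(round ^^ 1) (Check 0, replicate n 2, []) (Run [Emit False, Emit False], replicate n 1, [])"
        using round.silent[OF sw, of "Run [Emit False, Emit False]" "[]"] not True by (simp add: eq_OO)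
      have 2: "(round ^^ 1) (Run [Emit False, Emit False], replicate n 1, []) (Run [Emit False], replicate n 1, [False])"
        using round_Emit[of False "[Emit False]" "replicate n 1" "[]"] by (simp add: eq_OO)
      have 3: "(round ^^ 1) (Run [Emit False], replicate n 1, [False]) (Run [], replicate n 1, [False, False])"
        using round_Emit[of False "[]" "replicate n 1" "[False]"] by (simp add: eq_OO)
      have "(round ^^ (1 + 1 + 1)) (Check 0, map bit_sym x, []) (Run [], replicate n 1, rev (reduction S x))"
        using relpowp_trans[OF relpowp_trans[OF 1 2] 3] x False not True
        by (simp add: reduction_def n_def del: relpowp.simps)
      moreover have "1 + 1 + 1 \<le> 101 * (length x + 1)\<^sup>2" by (simp add: power2_eq_square)
      ultimately show ?thesis using stop by blast
    qed
  next
    case big: False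
    define k where "k = n - 3"
    \<comment> \<open>Three cells die, and the other \<open>k\<close> are live and unmarked, so both
      counters start at 0.\<close>
    have sw: "sweep (Check 0) (replicate n 2) = (Check 3, tape k (\<lambda>_. 0))"
      using big by (subst sweep_Check)
        (auto simp: tape_def cells_def k_def map_replicate_const numeral_3_eq_3)
    have 1: "(round ^^ 1) (Check 0, replicate n 2, []) (Run pair_com, tape k (\<lambda>_. 0), [])"
      using round.silent[OF sw, of "Run pair_com" "[]"] by (simp add: eq_OO)
    have 2: "(round ^^ rounds k pair_com) (Run (pair_com @ []), tape k (\<lambda>_. 0), [])
        (Run [], tape k (\<lambda>_. 0), [] @ out k pair_com)"
      by (intro rounds_Run nested_pair_com) simp
    have "(round ^^ (1 + rounds k pair_com)) (Check 0, map bit_sym x, []) (Run [], tape k (\<lambda>_. 0), rev (reduction S x))"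
      using relpowp_trans[OF 1, of "rounds k pair_com"] 2 x False big
      by (simp add: reduction_def n_def k_def del: relpowp.simps)
    moreover have "1 + rounds k pair_com \<le> 101 * (length x + 1)\<^sup>2"
    proof -
      have "(k + 1)\<^sup>2 \<le> (length x + 1)\<^sup>2" by (intro power_mono) (auto simp: k_def n_def)
      moreover have "1 \<le> (length x + 1)\<^sup>2" by simp
      ultimately show ?thesis using rounds_pair_com[of k] by linarith
    qed
    ultimately show ?thesis using stop by blast
  qed
qed

lemma poly_time_reduction: "poly_time_computable (reduction S)"
proof -
  have *: "(101 * (n + 1)\<^sup>2 + 1) * (2 * n + 2 * (101 * (n + 1)\<^sup>2) + 5) \<le> 102 * 209 * (n + 1) ^ 4" for n :: nat
  proof -
    \<comment> \<open>Both \<open>1\<close> and \<open>n + 1\<close> are at most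
      \<open>(n + 1)^2\<close>, so each factor is at most a constant times this square.\<close>
    have 1: "1 \<le> (n + 1)\<^sup>2" "n + 1 \<le> (n + 1)\<^sup>2" by (simp_all add: power2_eq_square)
    have "(101 * (n + 1)\<^sup>2 + 1) * (2 * n + 2 * (101 * (n + 1)\<^sup>2) + 5) \<le> (102 * (n + 1)\<^sup>2) * (209 * (n + 1)\<^sup>2)"
      using 1 by (intro mult_le_mono) linarith+
    also have "\<dots> = 102 * 209 * ((n + 1)\<^sup>2 * (n + 1)\<^sup>2)" by (simp only: ac_simps)
    also have "(n + 1)\<^sup>2 * (n + 1)\<^sup>2 = (n + 1) ^ 4" by (simp flip: power_add)
    finally show ?thesis .
  qed
  have "tm_computes_in_time M (reduction S) (\<lambda>n. (101 * (n + 1)\<^sup>2 + 1) * (2 * n + 2 * (101 * (n + 1)\<^sup>2) + 5))"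
    by (rule computes) (rule rounds_reduction)
  then have "tm_computes_in_time M (reduction S) (\<lambda>n. 102 * 209 * (n + 1) ^ 4)"
    unfolding tm_computes_in_time_def using * by (meson order_trans)
  then show ?thesis unfolding poly_time_computable_def using wf_M by blast
qed

end

section \<open>Correctness of the reduction\<close>

text \<open>The encoding is self-delimiting: the first \<open>False\<close> ends the unary
  \<open>n\<close>, and then exactly \<open>n * n\<close> matrix bits follow.\<close>

lemma enc_graph_inj:
  assumes "enc_graph n E @ r = enc_graph n' E' @ r'"
  shows "n = n' \<and> r = r' \<and> (\<forall>i<n. \<forall>j<n. E i j = E' i j)"
proof -
  have prefix: "takeWhile id (enc_graph l D @ z) = replicate l True" for l D z
    unfolding enc_graph_def by (simp add: takeWhile_append)
  have n: "n' = n"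
    using arg_cong[OF assms, of "\<lambda>z. length (takeWhile id z)"] by (simp add: prefix)
  let ?m = "\<lambda>D. concat (map (\<lambda>i. map (\<lambda>j. D i j) [0..<n]) [0..<n]) :: bool list"
  have len: "length (?m D) = n * n" for D :: "nat \<Rightarrow> nat \<Rightarrow> bool"
    by (simp add: length_concat comp_def sum_list_triv)
  have "?m E @ r = ?m E' @ r'"
    using assms unfolding n enc_graph_def by simp
  then have r: "r = r'" and m: "?m E = ?m E'"
    using len[of E] len[of E'] by (auto simp del: length_concat)
  have "E i j = E' i j" if "i < n" "j < n" for i j
  proof -
    have "i * n + j < n * n"
    proof -
      have "i * n + j < Suc i * n" using that by simp
      also have "\<dots> \<le> n * n" using that by (intro mult_le_mono) auto
      finally show ?thesis .
    qed
    moreover have "(i * n + j) div n = i" "(i * n + j) mod n = j" using that by simp_all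
    moreover have "\<forall>x\<in>{0..<n * n}. E (x div n) (x mod n) = E' (x div n) (x mod n)"
      using m that by (simp add: concat_grid)
    ultimately show ?thesis by (metis atLeastLessThan_iff le0)
  qed
  then show ?thesis using n r by simp
qed

lemma hom_cong:
  assumes "\<forall>i<n. \<forall>j<n. E i j = E' i j"
  shows "hom F ({0..<n}, E) = hom F ({0..<n}, E')"
  unfolding hom_def using assms
  by (intro arg_cong[where f = card] Collect_cong) (auto simp: PiE_iff)

text \<open>A word decodes to at most one pair of graphs up to adjacency outside the vertex sets,
  which homomorphism counts ignore.\<close>

lemma enc_graph_HomInd_iff:
  assumes "is_graph ({0..<n}, E)" "is_graph ({0..<m}, E')"
  shows "enc_graph n E @ enc_graph m E' \<in> HomInd \<F> \<longleftrightarrow>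
    hom_equiv \<F> ({0..<n}, E) ({0..<m}, E')"
proof
  assume "enc_graph n E @ enc_graph m E' \<in> HomInd \<F>"
  then obtain n1 E1 m1 E1' where eq: "enc_graph n E @ enc_graph m E' = enc_graph n1 E1 @ enc_graph m1 E1'"
    and h: "hom_equiv \<F> ({0..<n1}, E1) ({0..<m1}, E1')"
    unfolding HomInd_def by blast
  have 1: "n1 = n" "\<forall>i<n. \<forall>j<n. E i j = E1 i j" "enc_graph m E' @ [] = enc_graph m1 E1' @ []"
    using enc_graph_inj[OF eq] by simp_all
  then have 2: "m1 = m" "\<forall>i<m. \<forall>j<m. E' i j = E1' i j"
    using enc_graph_inj[OF 1(3)] by simp_all
  show "hom_equiv \<F> ({0..<n}, E) ({0..<m}, E')"
    using h hom_cong[OF 1(2)] hom_cong[OF 2(2)] unfolding 1(1) 2(1) hom_equiv_def by metis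
qed (use assms in \<open>auto simp: HomInd_def\<close>)

lemma Nil_notin_HomInd: "[] \<notin> HomInd \<F>"
  by (auto simp: HomInd_def enc_graph_def)

lemma is_graph_cut_edge: "is_graph ({0..<n}, cut_edge c)"
  by (auto simp: is_graph_def cut_edge_def)

lemma reduction_correct: "x \<in> NotIn S \<longleftrightarrow> reduction S x \<in> HomInd (K_class S)"
proof (cases "False \<in> set x")
  case True
  then show ?thesis by (auto simp: NotIn_def reduction_def Nil_notin_HomInd)
next
  case False
  have x: "x = replicate (length x) True"
    using False by (intro replicate_eqI) (auto, metis)
  have mem: "x \<in> NotIn S \<longleftrightarrow> length x \<notin> S"
  proof
    assume "length x \<notin> S"
    then show "x \<in> NotIn S" using x unfolding NotIn_def by blast
  qed (auto simp: NotIn_def)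
  show ?thesis
  proof (cases "length x < 3")
    case True
    have "[False, False] = enc_graph 0 (\<lambda>_ _. False) @ enc_graph 0 (\<lambda>_ _. False)"
      by (simp add: enc_graph_def)
    moreover have "enc_graph 0 (\<lambda>_ _. False) @ enc_graph 0 (\<lambda>_ _. False) \<in> HomInd (K_class S)"
      by (subst enc_graph_HomInd_iff) (simp_all add: is_graph_def hom_equiv_def)
    ultimately show ?thesis
      using True False mem Nil_notin_HomInd by (auto simp: reduction_def)
  next
    case big: False
    define k where "k = length x - 3"
    have k: "length x = k + 3" using big by (simp add: k_def)
    have "reduction S x = enc_graph (2 * k + 5) (cut_edge (k + 3)) @ enc_graph (2 * k + 5) (cut_edge (k + 4))"
      using False k by (simp add: reduction_def rev_out_pair_com)
    then have "reduction S x \<in> HomInd (K_class S) \<longleftrightarrow>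
        hom_equiv (K_class S) ({0..<2 * k + 5}, cut_edge (k + 3)) ({0..<2 * k + 5}, cut_edge (k + 4))"
      by (simp add: enc_graph_HomInd_iff is_graph_cut_edge)
    also have "\<dots> \<longleftrightarrow> k + 3 \<notin> S"
      using hom_equiv_cut[of S "k + 1"] by (simp add: eval_nat_numeral)
    finally show ?thesis using mem k by simp
  qed
qed

theorem theorem37:
  fixes S :: "nat set"
  shows "poly_many_one_reducible (NotIn S) (HomInd (K_class S))"
  unfolding poly_many_one_reducible_def
  using poly_time_reduction[of S] reduction_correct by blast
end
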